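(* Let $N>2$. Suppose that the dynamics are deterministic, i.e. for each $s\in S$, $a\in A_s$ and $t=1,\dots,N-1$ there exists $s^{+}\in S$ such that $p_t(s^{+}\mid s,a)=1$. Then $U_t(s)=e(V_t(s))$ for all $t\le N$ and all $s\in S$.
   Context: Setting (vector-valued Markov decision process). Integers $N$ and $m\ge1$ are fixed. $S$ is a finite set of states; for each $s\in S$, $A_s$ is a nonempty compact set of actions; $A=\bigcup_{s\in S}A_s$. For $t=1,\dots,N-1$, $s\in S$, $a\in A_s$, $R_t(s,a)\in\mathbb{R}^m$ is a vector reward, with components continuous in $a\in A_s$; $p_t(j\mid s,a)$ is the probability of state $j\in S$ at epoch $t+1$ given action $a$ in state $s$ at epoch $t$, continuous in $a\in A_s$. $R_N(s)\in\mathbb{R}^m$ is the terminal reward. A Markovian decision rule is a map $d:S\to A$ with $d(s)\in A_s$; the set $D$ of decision rules is assumed compact (topology of pointwise convergence). A (Markovian) policy is a sequence $\pi=(d_1,\dots,d_{N-1})$ of decision rules; $P_W$ is the set of all of them. Expected total rewards: $u_N^\pi(s)=R_N(s)$ and, for $t<N$, $u_t^\pi(s)=R_t(s,d_t(s))+\sum_{j\in S}p_t(j\mid s,d_t(s))\,u_{t+1}^\pi(j)$. Set $V_t(s)=\{u_t^\pi(s):\pi\in P_W\}$ for $t\le N$, $s\in S$. Order on $\mathbb{R}^m$: $x\ge y$ iff $x_i\ge y_i$ for all $i$. For $X\subseteq\mathbb{R}^m$, $e(X)=\{x\in X:\forall y\in X,\ y\ge x\Rightarrow y=x\}$. White's equations: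 define by backward recursion $U_N(s)=\{R_N(s)\}$ and, for $t<N$, $$U_t(s)=e\Bigl(\bigl\{R_t(s,a)+\textstyle\sum_{j\in S}p_t(j\mid s,a)v_j : a\in A_s,\ v_j\in U_{t+1}(j)\ \text{for all } j\in S\bigr\}\Bigr).$$ *)

theory Defs
  imports "HOL-Analysis.Analysis"
begin

text \<open>The order on \<open>real ^ 'm\<close> is the componentwise one.\<close>

definition efficient :: "(real ^ 'm) set \<Rightarrow> (real ^ 'm) set" where
  "efficient X = {x \<in> X. \<forall>y\<in>X. y \<ge> x \<longrightarrow> y = x}"

text \<open>
  Actions live in an arbitrary topological space; \<open>p t s a j\<close> is the probability of moving to
  state \<open>j\<close> at epoch \<open>t + 1\<close> when action \<open>a\<close> is taken in state \<open>s\<close> at epoch \<open>t\<close>. Decision rules are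
  the elements of \<open>Pi\<^sub>E S A\<close>, that is, maps on \<open>S\<close> padded by \<open>undefined\<close> outside \<open>S\<close>; compactness
  refers to the product topology on the function type, which is that of pointwise convergence.
\<close>

locale vector_mdp =
  fixes N :: nat
    and S :: "'s set"
    and A :: "'s \<Rightarrow> 'a::topological_space set"
    and R :: "nat \<Rightarrow> 's \<Rightarrow> 'a \<Rightarrow> real ^ 'm"
    and p :: "nat \<Rightarrow> 's \<Rightarrow> 'a \<Rightarrow> 's \<Rightarrow> real"
  assumes finite_states: "finite S"
    and actions_nonempty: "\<And>s. s \<in> S \<Longrightarrow> A s \<noteq> {}"
    and actions_compact: "\<And>s. s \<in> S \<Longrightarrow> compact (A s)"
    and reward_continuous:
      "\<And>t s i. t \<in> {1..<N} \<Longrightarrow> s \<in> S \<Longrightarrow> continuous_on (A s) (\<lambda>a. R t s a $ i)"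
    and prob_nonneg:
      "\<And>t s a j. t \<in> {1..<N} \<Longrightarrow> s \<in> S \<Longrightarrow> a \<in> A s \<Longrightarrow> j \<in> S \<Longrightarrow> p t s a j \<ge> 0"
    and prob_sum:
      "\<And>t s a. t \<in> {1..<N} \<Longrightarrow> s \<in> S \<Longrightarrow> a \<in> A s \<Longrightarrow> (\<Sum>j\<in>S. p t s a j) = 1"
    and prob_continuous:
      "\<And>t s j. t \<in> {1..<N} \<Longrightarrow> s \<in> S \<Longrightarrow> j \<in> S \<Longrightarrow> continuous_on (A s) (\<lambda>a. p t s a j)"
    and decision_rules_compact: "compact (Pi\<^sub>E S A)"

definition policies :: "nat \<Rightarrow> 's set \<Rightarrow> ('s \<Rightarrow> 'a set) \<Rightarrow> (nat \<Rightarrow> 's \<Rightarrow> 'a) set" where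
  "policies N S A = {1..<N} \<rightarrow>\<^sub>E Pi\<^sub>E S A"

text \<open>Both recursions below run backwards from \<open>N\<close>; only epochs \<open>1 \<le> t \<le> N\<close> are meaningful.\<close>

function total_reward ::
  "nat \<Rightarrow> 's set \<Rightarrow> (nat \<Rightarrow> 's \<Rightarrow> 'a \<Rightarrow> real ^ 'm) \<Rightarrow> ('s \<Rightarrow> real ^ 'm) \<Rightarrow>
    (nat \<Rightarrow> 's \<Rightarrow> 'a \<Rightarrow> 's \<Rightarrow> real) \<Rightarrow> (nat \<Rightarrow> 's \<Rightarrow> 'a) \<Rightarrow> nat \<Rightarrow> 's \<Rightarrow> real ^ 'm" where
  "total_reward N S R RN p d t s =
    (if t < N then
       R t s (d t s) + (\<Sum>j\<in>S. p t s (d t s) j *\<^sub>R total_reward N S R RN p d (t + 1) j)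
     else RN s)"
  by pat_completeness auto
termination
  by (relation "Wellfounded.measure (\<lambda>(N, S, R, RN, p, d, t, s). N - t)") auto

definition value_set ::
  "nat \<Rightarrow> 's set \<Rightarrow> ('s \<Rightarrow> 'a set) \<Rightarrow> (nat \<Rightarrow> 's \<Rightarrow> 'a \<Rightarrow> real ^ 'm) \<Rightarrow> ('s \<Rightarrow> real ^ 'm) \<Rightarrow>
    (nat \<Rightarrow> 's \<Rightarrow> 'a \<Rightarrow> 's \<Rightarrow> real) \<Rightarrow> nat \<Rightarrow> 's \<Rightarrow> (real ^ 'm) set" where
  "value_set N S A R RN p t s = {total_reward N S R RN p d t s | d. d \<in> policies N S A}"

function white_set ::
  "nat \<Rightarrow> 's set \<Rightarrow> ('s \<Rightarrow> 'a set) \<Rightarrow> (nat \<Rightarrow> 's \<Rightarrow> 'a \<Rightarrow> real ^ 'm) \<Rightarrow> ('s \<Rightarrow> real ^ 'm) \<Rightarrow>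
    (nat \<Rightarrow> 's \<Rightarrow> 'a \<Rightarrow> 's \<Rightarrow> real) \<Rightarrow> nat \<Rightarrow> 's \<Rightarrow> (real ^ 'm) set" where
  "white_set N S A R RN p t s =
    (if t < N then
       efficient {R t s a + (\<Sum>j\<in>S. p t s a j *\<^sub>R v j) | a v.
                    a \<in> A s \<and> (\<forall>j\<in>S. v j \<in> white_set N S A R RN p (t + 1) j)}
     else {RN s})"
  by pat_completeness auto
termination
  by (relation "Wellfounded.measure (\<lambda>(N, S, A, R, RN, p, t, s). N - t)") auto

declare total_reward.simps [simp del] white_set.simps [simp del]

end

theory Submission
  imports Defs
begin

text \<open>
  In the deterministic case a Markovian policy steers towards a single successor, so the value sets
  themselves satisfy White's recursion without the operator \<open>e\<close>. By backward induction they are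
  nonempty and compact, so every value is dominated by an efficient one. Restricting the
  continuation values to efficient ones therefore does not change the efficient set.
\<close>

lemma efficient_subset: "efficient X \<subseteq> X"
  by (auto simp: efficient_def)

lemma efficient_singleton [simp]: "efficient {x} = {x}"
  by (auto simp: efficient_def)

text \<open>A point of \<open>efficient Y\<close> lies below some point of \<open>X\<close>, hence
  equals it and belongs to \<open>X\<close>. Conversely, anything in \<open>Y\<close> above
  \<open>x \<in> efficient X\<close> is squeezed between \<open>x\<close> and a point of
  \<open>X\<close> that has to be \<open>x\<close> again.\<close>

lemma efficient_eqI:
  assumes "X \<subseteq> Y" and dom: "\<And>y. y \<in> Y \<Longrightarrow> \<exists>x\<in>X. y \<le> x"
  shows "efficient X = efficient Y"
proof (intro equalityI subsetI)
  fix x assume x: "x \<in> efficient X"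
  have "y = x" if y: "y \<in> Y" "x \<le> y" for y
  proof -
    obtain z where z: "z \<in> X" "y \<le> z" using dom y(1) by blast
    with y(2) have "z = x" using x by (auto simp: efficient_def)
    with z y(2) show ?thesis by (simp add: order_antisym)
  qed
  with x assms(1) show "x \<in> efficient Y" by (auto simp: efficient_def)
next
  fix y assume y: "y \<in> efficient Y"
  then obtain x where "x \<in> X" "y \<le> x" using dom by (auto simp: efficient_def)
  with y assms(1) have "y \<in> X" by (auto simp: efficient_def)
  with y assms(1) show "y \<in> efficient X" by (auto simp: efficient_def)
qed

text \<open>Maximise the coordinate sum over the compact part of \<open>X\<close> above
  \<open>x\<close>. The sum is strictly monotone for the componentwise order, so nothing in
  \<open>X\<close> lies strictly above a maximiser.\<close>

lemma compact_efficient_dominates: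
  fixes X :: "(real ^ 'm) set"
  assumes "compact X" "x \<in> X"
  shows "\<exists>y\<in>efficient X. x \<le> y"
proof -
  have "{y. x \<le> y} = (\<Inter>i. {y. x $ i \<le> y $ i})"
    by (auto simp: less_eq_vec_def)
  then have "closed {y. x \<le> y}"
    by (simp add: closed_INT closed_Collect_le continuous_on_component)
  with assms(1) have "compact (X \<inter> {y. x \<le> y})" by (rule compact_Int_closed)
  moreover have "X \<inter> {y. x \<le> y} \<noteq> {}" using assms(2) by auto
  moreover have "continuous_on (X \<inter> {y. x \<le> y}) (\<lambda>y. \<Sum>i\<in>UNIV. y $ i)"
    by (intro continuous_intros)
  ultimately obtain y where y: "y \<in> X" "x \<le> y"
    and max: "\<And>z. z \<in> X \<Longrightarrow> x \<le> z \<Longrightarrow> (\<Sum>i\<in>UNIV. z $ i) \<le> (\<Sum>i\<in>UNIV. y $ i)"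
    using continuous_attains_sup[of "X \<inter> {y. x \<le> y}" "\<lambda>y. \<Sum>i\<in>UNIV. y $ i"] by auto
  have "z = y" if z: "z \<in> X" "y \<le> z" for z
  proof (rule ccontr)
    assume "z \<noteq> y"
    then obtain i where "y $ i \<noteq> z $ i" by (metis vec_eq_iff)
    moreover have le: "y $ i \<le> z $ i" for i using z(2) by (simp add: less_eq_vec_def)
    ultimately have "(\<Sum>i\<in>UNIV. y $ i) < (\<Sum>i\<in>UNIV. z $ i)"
      by (intro sum_strict_mono_ex1) (auto intro: le_neq_trans)
    \<comment> \<open>By transitivity \<open>z\<close> is itself above \<open>x\<close>, so it
      competes in the maximisation.\<close>
    moreover have "(\<Sum>i\<in>UNIV. z $ i) \<le> (\<Sum>i\<in>UNIV. y $ i)"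
      using z y(2) by (intro max) (auto intro: order_trans)
    ultimately show False by simp
  qed
  with y show ?thesis by (auto simp: efficient_def)
qed

text \<open>The recursion never looks at rules before epoch \<open>t\<close>. This allows the rule
  at one epoch to be changed without affecting the continuation.\<close>

lemma total_reward_cong:
  assumes "\<And>t' s. t \<le> t' \<Longrightarrow> t' < N \<Longrightarrow> d t' s = d' t' s"
  shows "total_reward N S R RN p d t s = total_reward N S R RN p d' t s"
  using assms
proof (induction "N - t" arbitrary: t s)
  case 0
  then show ?case by (simp add: total_reward.simps)
next
  case (Suc n)
  have "total_reward N S R RN p d (t + 1) j = total_reward N S R RN p d' (t + 1) j" for j
    by (rule Suc.hyps(1)) (use Suc.hyps(2) Suc.prems in auto)
  moreover have "d t s = d' t s" using Suc.hyps(2) by (intro Suc.prems) auto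
  ultimately show ?case by (subst (1 2) total_reward.simps) simp
qed

text \<open>One step of White's recursion without \<open>efficient\<close>, for arbitrary
  continuation sets \<open>V\<close>, so that it serves both value sets and White's sets. Expressing
  the successor by \<open>p t s a j = 1\<close> avoids choosing a transition function.\<close>

definition deterministic_step ::
  "'s set \<Rightarrow> ('s \<Rightarrow> 'a set) \<Rightarrow> (nat \<Rightarrow> 's \<Rightarrow> 'a \<Rightarrow> real ^ 'm) \<Rightarrow>
    (nat \<Rightarrow> 's \<Rightarrow> 'a \<Rightarrow> 's \<Rightarrow> real) \<Rightarrow> nat \<Rightarrow> 's \<Rightarrow> ('s \<Rightarrow> (real ^ 'm) set) \<Rightarrow> (real ^ 'm) set"
where
  "deterministic_step S A R p t s V =
    {R t s a + v | a j v. a \<in> A s \<and> j \<in> S \<and> p t s a j = 1 \<and> v \<in> V j}"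

text \<open>By compactness each continuation value lies below an efficient one, and adding
  \<open>R t s a\<close> preserves the order; \<open>efficient_eqI\<close> then applies.\<close>

lemma efficient_deterministic_step_efficient:
  assumes "\<And>j. j \<in> S \<Longrightarrow> compact (V j)"
  shows "efficient (deterministic_step S A R p t s (\<lambda>j. efficient (V j))) =
    efficient (deterministic_step S A R p t s V)"
proof (rule efficient_eqI)
  show "deterministic_step S A R p t s (\<lambda>j. efficient (V j)) \<subseteq> deterministic_step S A R p t s V"
    using efficient_subset unfolding deterministic_step_def by blast
next
  fix y assume "y \<in> deterministic_step S A R p t s V"
  then obtain a j v where y: "y = R t s a + v" "a \<in> A s" "j \<in> S" "p t s a j = 1" "v \<in> V j"
    by (auto simp: deterministic_step_def)
  then obtain w where "w \<in> efficient (V j)" "v \<le> w"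
    using compact_efficient_dominates assms by blast
  with y show "\<exists>x\<in>deterministic_step S A R p t s (\<lambda>j. efficient (V j)). y \<le> x"
    unfolding deterministic_step_def by (intro bexI[of _ "R t s a + w"]) (auto intro: add_left_mono)
qed

locale deterministic_mdp = vector_mdp N S A R p
  for N :: nat and S :: "'s set" and A :: "'s \<Rightarrow> 'a::topological_space set"
    and R :: "nat \<Rightarrow> 's \<Rightarrow> 'a \<Rightarrow> real ^ 'm" and p :: "nat \<Rightarrow> 's \<Rightarrow> 'a \<Rightarrow> 's \<Rightarrow> real" +
  fixes RN :: "'s \<Rightarrow> real ^ 'm"
  assumes deterministic:
    "\<And>t s a. t \<in> {1..<N} \<Longrightarrow> s \<in> S \<Longrightarrow> a \<in> A s \<Longrightarrow> \<exists>j\<in>S. p t s a j = 1"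
begin

lemma policies_nonempty: "policies N S A \<noteq> {}"
  using actions_nonempty by (auto simp: policies_def PiE_eq_empty_iff)

text \<open>Nonnegative probabilities of total mass 1 leave nothing for states other than
  \<open>j\<close>.\<close>

lemma sum_prob_eq:
  fixes v :: "'s \<Rightarrow> real ^ 'm"
  assumes "t \<in> {1..<N}" "s \<in> S" "a \<in> A s" "j \<in> S" "p t s a j = 1"
  shows "(\<Sum>i\<in>S. p t s a i *\<^sub>R v i) = v j"
proof -
  have "(\<Sum>i\<in>S - {j}. p t s a i) = 0"
    using prob_sum[OF assms(1-3)] finite_states assms(4,5) by (simp add: sum_diff1)
  then have "p t s a i = 0" if "i \<in> S - {j}" for i
    using that prob_nonneg[OF assms(1-3)] finite_states by (subst (asm) sum_nonneg_eq_0_iff) auto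
  then have "(\<Sum>i\<in>S. p t s a i *\<^sub>R v i) = (\<Sum>i\<in>{j}. p t s a i *\<^sub>R v i)"
    using finite_states assms(4) by (intro sum.mono_neutral_right) auto
  with assms(5) show ?thesis by simp
qed

lemma value_set_terminal: "value_set N S A R RN p N s = {RN s}"
  using policies_nonempty by (auto simp: value_set_def total_reward.simps)

text \<open>This is where determinism is essential. Only one continuation value enters, so the
  policy attaining it can be reused. With several random successors, policies attaining values from
  different states would have to be merged, and they may prescribe different actions at a common
  later state.\<close>

lemma value_set_step:
  assumes t: "t \<in> {1..<N}" and s: "s \<in> S"
  shows "value_set N S A R RN p t s =
    deterministic_step S A R p t s (value_set N S A R RN p (t + 1))"
proof (intro equalityI subsetI)
  fix x assume "x \<in> value_set N S A R RN p t s"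
  then obtain d where d: "d \<in> policies N S A" and x: "x = total_reward N S R RN p d t s"
    by (auto simp: value_set_def)
  have a: "d t s \<in> A s" using d t s by (auto simp: policies_def PiE_iff)
  then obtain j where j: "j \<in> S" "p t s (d t s) j = 1" using deterministic t s by blast
  have "x = R t s (d t s) + total_reward N S R RN p d (t + 1) j"
    unfolding x using t sum_prob_eq[OF t s a j]
    by (subst total_reward.simps) simp
  with a j d show "x \<in> deterministic_step S A R p t s (value_set N S A R RN p (t + 1))"
    unfolding deterministic_step_def value_set_def by blast
next
  fix x assume "x \<in> deterministic_step S A R p t s (value_set N S A R RN p (t + 1))"
  then obtain a j d where a: "a \<in> A s" and j: "j \<in> S" "p t s a j = 1" and d: "d \<in> policies N S A"
    and x: "x = R t s a + total_reward N S R RN p d (t + 1) j"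
    by (auto simp: deterministic_step_def value_set_def)
  \<comment> \<open>Only the action at epoch \<open>t\<close> in state \<open>s\<close> changes; all
    rules from \<open>t + 1\<close> on are those of \<open>d\<close>.\<close>
  define d' where "d' = d(t := (d t)(s := a))"
  have d': "d' \<in> policies N S A"
    using d t s a by (auto simp: d'_def policies_def PiE_iff extensional_def)
  have "total_reward N S R RN p d' (t + 1) j = total_reward N S R RN p d (t + 1) j"
    by (rule total_reward_cong) (simp add: d'_def)
  then have "x = total_reward N S R RN p d' t s"
    unfolding x using t sum_prob_eq[OF t s a j]
    by (subst (2) total_reward.simps) (simp add: d'_def)
  with d' show "x \<in> value_set N S A R RN p t s" by (auto simp: value_set_def)
qed

lemma value_set_nonempty: "value_set N S A R RN p t s \<noteq> {}"
  using policies_nonempty by (auto simp: value_set_def)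

text \<open>Sorting the actions by their successor gives a finite union of continuous images of the
  compact products \<open>B j \<times> V j\<close>.\<close>

lemma compact_deterministic_step:
  assumes t: "t \<in> {1..<N}" and s: "s \<in> S" and V: "\<And>j. j \<in> S \<Longrightarrow> compact (V j)"
  shows "compact (deterministic_step S A R p t s V)"
proof -
  define B where "B j = {a \<in> A s. p t s a j = 1}" for j
  have "deterministic_step S A R p t s V = (\<Union>j\<in>S. (\<lambda>(a, v). R t s a + v) ` (B j \<times> V j))"
    by (force simp: deterministic_step_def B_def)
  moreover have "compact ((\<lambda>(a, v). R t s a + v) ` (B j \<times> V j))" if j: "j \<in> S" for j
  proof (rule compact_continuous_image)
    \<comment> \<open>The action space need not be Hausdorff, so \<open>A s\<close> may fail to be
      closed. Relative closedness of \<open>B j\<close> in \<open>A s\<close> suffices: it is the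
      trace of a closed set on a compact one.\<close>
    obtain T where "closed T" and T: "T \<inter> A s = (\<lambda>a. p t s a j) -` {1} \<inter> A s"
      using prob_continuous[OF t s j] unfolding continuous_on_closed_invariant by blast
    then have "B j = A s \<inter> T" by (auto simp: B_def)
    with \<open>closed T\<close> have "compact (B j)" using actions_compact[OF s] by (simp add: compact_Int_closed)
    then show "compact (B j \<times> V j)" using V[OF j] by (rule compact_Times)
    \<comment> \<open>Continuity is assumed per component, so the vector is reassembled from its
      coordinates.\<close>
    have "continuous_on (A s) (\<lambda>a. \<chi> i. R t s a $ i)"
      by (intro continuous_on_vec_lambda reward_continuous t s)
    then have "continuous_on (B j) (R t s)"
      by (auto simp: B_def intro: continuous_on_subset)
    then have "continuous_on (B j \<times> V j) (\<lambda>z. R t s (fst z))"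
      by (rule continuous_on_compose2) (auto intro: continuous_intros)
    then show "continuous_on (B j \<times> V j) (\<lambda>(a, v). R t s a + v)"
      unfolding case_prod_beta by (intro continuous_intros)
  qed
  ultimately show ?thesis using finite_states by (simp add: compact_UN)
qed

lemma compact_value_set:
  assumes "t \<in> {1..N}" "s \<in> S"
  shows "compact (value_set N S A R RN p t s)"
  using assms
proof (induction "N - t" arbitrary: t s)
  case 0
  then have "t = N" by simp
  then show ?case by (simp add: value_set_terminal)
next
  case (Suc n)
  have t: "t \<in> {1..<N}" using Suc by auto
  have "compact (value_set N S A R RN p (t + 1) j)" if "j \<in> S" for j
    by (rule Suc.hyps(1)) (use Suc.hyps(2) t that in auto)
  then show ?case
    unfolding value_set_step[OF t Suc.prems(2)] by (rule compact_deterministic_step[OF t Suc.prems(2)])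
qed

text \<open>The selection \<open>v\<close> in White's equation needs a value at every state, even
  one of probability 0. A single empty set would empty the whole right-hand side of that equation,
  hence the assumption \<open>ne\<close>.\<close>

lemma white_set_step:
  assumes t: "t \<in> {1..<N}" and s: "s \<in> S"
    and ne: "\<And>j. j \<in> S \<Longrightarrow> white_set N S A R RN p (t + 1) j \<noteq> {}"
  shows "white_set N S A R RN p t s =
    efficient (deterministic_step S A R p t s (white_set N S A R RN p (t + 1)))"
proof -
  let ?U = "white_set N S A R RN p (t + 1)"
  have "{R t s a + (\<Sum>j\<in>S. p t s a j *\<^sub>R v j) | a v. a \<in> A s \<and> (\<forall>j\<in>S. v j \<in> ?U j)} =
    deterministic_step S A R p t s ?U" (is "?X = ?Y")
  proof (intro equalityI subsetI)
    fix x assume "x \<in> ?X"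
    then obtain a v where a: "a \<in> A s" and v: "\<forall>j\<in>S. v j \<in> ?U j"
      and x: "x = R t s a + (\<Sum>j\<in>S. p t s a j *\<^sub>R v j)" by blast
    obtain j where j: "j \<in> S" "p t s a j = 1" using deterministic t s a by blast
    have "x = R t s a + v j" using x sum_prob_eq[OF t s a j] by simp
    with a j v show "x \<in> ?Y" unfolding deterministic_step_def by blast
  next
    fix x assume "x \<in> ?Y"
    then obtain a j u where a: "a \<in> A s" and j: "j \<in> S" "p t s a j = 1" and u: "u \<in> ?U j"
      and x: "x = R t s a + u" by (auto simp: deterministic_step_def)
    \<comment> \<open>Values away from the successor \<open>j\<close> are arbitrary members, since
      they get weight 0.\<close>
    define v where "v = (\<lambda>i. SOME w. w \<in> ?U i)(j := u)"
    have "\<forall>i\<in>S. v i \<in> ?U i" using u ne by (auto simp: v_def some_in_eq)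
    moreover have "x = R t s a + (\<Sum>i\<in>S. p t s a i *\<^sub>R v i)"
      using x sum_prob_eq[OF t s a j] by (simp add: v_def)
    ultimately show "x \<in> ?X" using a by blast
  qed
  then show ?thesis using t by (subst white_set.simps) simp
qed

lemma white_set_eq_efficient_value_set:
  assumes "t \<in> {1..N}" "s \<in> S"
  shows "white_set N S A R RN p t s = efficient (value_set N S A R RN p t s)"
  using assms
proof (induction "N - t" arbitrary: t s)
  case 0
  then have "t = N" by simp
  then show ?case by (simp add: value_set_terminal white_set.simps)
next
  case (Suc n)
  have t: "t \<in> {1..<N}" using Suc by auto
  let ?U = "white_set N S A R RN p (t + 1)" and ?V = "value_set N S A R RN p (t + 1)"
  have IH: "?U j = efficient (?V j)" if "j \<in> S" for j
    by (rule Suc.hyps(1)) (use Suc.hyps(2) t that in auto)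
  have compact: "compact (?V j)" if "j \<in> S" for j
    using compact_value_set t that by simp
  \<comment> \<open>Domination in the compact set \<open>?V j\<close> turns its nonemptiness into
    that of its efficient part.\<close>
  have "?U j \<noteq> {}" if "j \<in> S" for j
  proof -
    obtain v where "v \<in> ?V j" using value_set_nonempty by blast
    with compact_efficient_dominates[OF compact[OF that]] have "efficient (?V j) \<noteq> {}" by blast
    then show ?thesis using IH[OF that] by simp
  qed
  then have "white_set N S A R RN p t s = efficient (deterministic_step S A R p t s ?U)"
    by (rule white_set_step[OF t Suc.prems(2)])
  \<comment> \<open>The induction hypothesis holds only on \<open>S\<close>, which is enough because
    \<open>deterministic_step\<close> consults only successors in \<open>S\<close>.\<close>
  also have "deterministic_step S A R p t s ?U =
      deterministic_step S A R p t s (\<lambda>j. efficient (?V j))"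
    using IH unfolding deterministic_step_def by blast
  also have "efficient \<dots> = efficient (deterministic_step S A R p t s ?V)"
    using compact by (rule efficient_deterministic_step_efficient)
  finally show ?case by (simp only: value_set_step[OF t Suc.prems(2)])
qed

end

theorem corollary2:
  fixes N :: nat
    and S :: "'s set"
    and A :: "'s \<Rightarrow> 'a::topological_space set"
    and R :: "nat \<Rightarrow> 's \<Rightarrow> 'a \<Rightarrow> real ^ 'm"
    and RN :: "'s \<Rightarrow> real ^ 'm"
    and p :: "nat \<Rightarrow> 's \<Rightarrow> 'a \<Rightarrow> 's \<Rightarrow> real"
  assumes "vector_mdp N S A R p"
    and "N > 2"
    and deterministic:
      "\<forall>s\<in>S. \<forall>a\<in>A s. \<forall>t\<in>{1..N - 1}. \<exists>s'\<in>S. p t s a s' = 1"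
  shows "\<forall>t\<in>{1..N}. \<forall>s\<in>S.
    white_set N S A R RN p t s = efficient (value_set N S A R RN p t s)"
proof -
  interpret vector_mdp N S A R p by fact
  interpret deterministic_mdp N S A R p RN
    by unfold_locales (use deterministic in auto)
  show ?thesis using white_set_eq_efficient_value_set by blast
qed

end
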